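(* Suppose that for both the space of quadratic polynomials $z\mapsto z^2+c$ and the space of exponential maps $z\mapsto e^z+c$ ($c\in\mathbb{C}$), all fibers are trivial. Then for both of these families, every connected component of the locus of stability $\mathcal{R}$ is a hyperbolic component (equivalently, hyperbolic dynamics is open and dense in parameter space).
   Context: Let $(f_c)_{c\in\mathbb{C}}$ be one of the families $f_c(z)=z^2+c$ (quadratic) or $f_c(z)=e^z+c$ (exponential). Stability. $f_c$ is stable if, for $c'$ sufficiently close to $c$, $f_c$ and $f_{c'}$ are topologically conjugate on their Julia sets, with the conjugacy depending continuously on $c'$. The locus of stability $\mathcal{R}$ is the (open, dense) set of all $c\in\mathbb{C}$ with $f_c$ stable. The escape locus is $\mathcal{I}:=\{c\in\mathbb{C}: f_c^{\circ n}(c)\to\infty\}$. A hyperbolic component is a connected component of $\mathcal{R}$ in which every $f_c$ has an attracting periodic orbit in $\mathbb{C}$ of constant period, or, in the quadratic case only, the set $\mathcal{I}=\mathbb{C}\setminus\mathcal{M}$ (the complement of the Mandelbrot set, where the attracting orbit is $\infty$). A hyperbolic parameter is a point of a hyperbolic component. A parabolic parameter is a $c$ for which $f_c$ has a periodic orbit whose multiplier is a root of unity. The set $\mathcal{I}_R$. In the exponential case it is known that every path component of $\mathcal{I}$ is a simple curve $G\colon(0,\infty)\to\mathcal{I}$ or $G\colon[0,\infty)\to\mathcal{I}$ with $G(t)\to\infty$ as $t\to\infty$; in both cases $G((0,\infty))$ is called a parameter ray, and $\mathcal{I}_R$ is the union of all parameter rays. In the quadratic case put $\mathcal{I}_R=\emptyset$.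 Fibers. A separation line is a Jordan arc $\gamma\subset\mathbb{C}$ in parameter space, tending to $\infty$ in both directions and containing only hyperbolic and finitely many parabolic parameters. It separates $c$ and $c'$ if $c$ and $c'$ lie in two different components of $\mathbb{C}\setminus\gamma$. The extended fiber of $c\in\mathbb{C}$ is the set of all $c'\in\mathbb{C}$ which cannot be separated from $c$ by any separation line. The (reduced) fiber of $c\in\mathbb{C}\setminus\mathcal{I}_R$ consists of all $c'$ in the extended fiber of $c$ which do not belong to $\mathcal{I}_R$. A fiber is trivial if it consists of exactly one point. *)

theory Defs
  imports "HOL-Complex_Analysis.Complex_Analysis"
begin

datatype family = Quadratic | Exponential

fun fam :: "family \<Rightarrow> complex \<Rightarrow> complex \<Rightarrow> complex" where
  "fam Quadratic c z = z\<^sup>2 + c"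
| "fam Exponential c z = exp z + c"

text \<open>
  Normality on an open set is meant with respect to the spherical metric. For holomorphic
  complex-valued functions the possible locally uniform limits on a connected open set are
  complex-valued functions and the constant \<open>\<infinity>\<close>.
  As Fatou points are defined by the existence of a neighbourhood (which may be shrunk to a disc),
  connectedness need not be required.
\<close>

definition locally_uniform_to_infinity :: "complex set \<Rightarrow> (nat \<Rightarrow> complex \<Rightarrow> complex) \<Rightarrow> bool" where
  "locally_uniform_to_infinity U s \<longleftrightarrow>
     (\<forall>K. compact K \<and> K \<subseteq> U \<longrightarrow>
        (\<forall>B::real. \<forall>\<^sub>F n in sequentially. \<forall>z\<in>K. B \<le> norm (s n z)))"

definition normal_family :: "complex set \<Rightarrow> (complex \<Rightarrow> complex) set \<Rightarrow> bool" where
  "normal_family U \<F> \<longleftrightarrow>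
     (\<forall>s::nat \<Rightarrow> complex \<Rightarrow> complex. range s \<subseteq> \<F> \<longrightarrow>
        (\<exists>r::nat \<Rightarrow> nat. strict_mono r \<and>
           ((\<exists>g. \<forall>K. compact K \<and> K \<subseteq> U \<longrightarrow> uniform_limit K (s \<circ> r) g sequentially) \<or>
            locally_uniform_to_infinity U (s \<circ> r))))"

definition fatou_set :: "(complex \<Rightarrow> complex) \<Rightarrow> complex set" where
  "fatou_set f = {z. \<exists>U. open U \<and> z \<in> U \<and> normal_family U (range (\<lambda>n. f ^^ n))}"

definition julia_set :: "(complex \<Rightarrow> complex) \<Rightarrow> complex set" where
  "julia_set f = - fatou_set f"

text \<open>
  Continuous dependence of the conjugacy on the parameter is with respect to locally uniform
  convergence on the Julia set of \<open>fam F c\<close>. Since that set is closed, hence locally compact,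
  this is joint continuity in the parameter and the point.
\<close>

definition stable :: "family \<Rightarrow> complex \<Rightarrow> bool" where
  "stable F c \<longleftrightarrow>
     (\<exists>\<epsilon>>0. \<exists>h :: complex \<Rightarrow> complex \<Rightarrow> complex.
        (\<forall>c'\<in>ball c \<epsilon>.
           (\<exists>g. homeomorphism (julia_set (fam F c)) (julia_set (fam F c')) (h c') g) \<and>
           (\<forall>z\<in>julia_set (fam F c). h c' (fam F c z) = fam F c' (h c' z))) \<and>
        continuous_on (ball c \<epsilon> \<times> julia_set (fam F c)) (\<lambda>(c', z). h c' z))"

definition stability_locus :: "family \<Rightarrow> complex set" where
  "stability_locus F = {c. stable F c}"

definition escape_locus :: "family \<Rightarrow> complex set" where
  "escape_locus F = {c. filterlim (\<lambda>n. (fam F c ^^ n) c) at_infinity sequentially}"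

definition periodic_point :: "(complex \<Rightarrow> complex) \<Rightarrow> nat \<Rightarrow> complex \<Rightarrow> bool" where
  "periodic_point f p z \<longleftrightarrow>
     0 < p \<and> (f ^^ p) z = z \<and> (\<forall>k. 0 < k \<and> k < p \<longrightarrow> (f ^^ k) z \<noteq> z)"

definition multiplier :: "(complex \<Rightarrow> complex) \<Rightarrow> nat \<Rightarrow> complex \<Rightarrow> complex" where
  "multiplier f p z = deriv (f ^^ p) z"

text \<open>
  The quadratic escape locus, where the attracting orbit is \<open>\<infinity>\<close>, is the complement of the
  Mandelbrot set; it is a single component of the stability locus.
\<close>

definition hyperbolic_component :: "family \<Rightarrow> complex set \<Rightarrow> bool" where
  "hyperbolic_component F U \<longleftrightarrow>
     U \<in> components (stability_locus F) \<and>
     ((\<exists>p. \<forall>c\<in>U. \<exists>z. periodic_point (fam F c) p z \<and> norm (multiplier (fam F c) p z) < 1) \<or>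
      F = Quadratic \<and> U = escape_locus Quadratic)"

definition hyperbolic_parameters :: "family \<Rightarrow> complex set" where
  "hyperbolic_parameters F = \<Union> {U. hyperbolic_component F U}"

definition parabolic_parameters :: "family \<Rightarrow> complex set" where
  "parabolic_parameters F =
     {c. \<exists>p z. periodic_point (fam F c) p z \<and> (\<exists>k>0. multiplier (fam F c) p z ^ k = 1)}"

text \<open>
  \<open>G\<close> parametrises a whole path component of the escape locus, possibly including a finite
  endpoint \<open>G 0\<close>; the endpoint does not belong to the ray. That every path component has
  such a parametrisation is a theorem, which is not presupposed here.
\<close>

definition parameter_ray :: "complex set \<Rightarrow> bool" where
  "parameter_ray A \<longleftrightarrow>
     (\<exists>(G :: real \<Rightarrow> complex) T. \<exists>c \<in> escape_locus Exponential.
        (T = {0<..} \<or> T = {0..}) \<and>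
        continuous_on T G \<and> inj_on G T \<and>
        G ` T = path_component_set (escape_locus Exponential) c \<and>
        filterlim G at_infinity at_top \<and>
        A = G ` {0<..})"

fun ray_locus :: "family \<Rightarrow> complex set" where
  "ray_locus Quadratic = {}"
| "ray_locus Exponential = \<Union> {A. parameter_ray A}"

definition separation_line :: "family \<Rightarrow> complex set \<Rightarrow> bool" where
  "separation_line F \<gamma> \<longleftrightarrow>
     (\<exists>g :: real \<Rightarrow> complex.
        continuous_on UNIV g \<and> inj g \<and> \<gamma> = range g \<and>
        filterlim g at_infinity at_top \<and> filterlim g at_infinity at_bot) \<and>
     \<gamma> \<subseteq> hyperbolic_parameters F \<union> parabolic_parameters F \<and>
     finite (\<gamma> \<inter> parabolic_parameters F)"

definition separates :: "complex set \<Rightarrow> complex \<Rightarrow> complex \<Rightarrow> bool" where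
  "separates \<gamma> c c' \<longleftrightarrow>
     (\<exists>A\<in>components (- \<gamma>). \<exists>B\<in>components (- \<gamma>). A \<noteq> B \<and> c \<in> A \<and> c' \<in> B)"

definition extended_fiber :: "family \<Rightarrow> complex \<Rightarrow> complex set" where
  "extended_fiber F c = {c'. \<not> (\<exists>\<gamma>. separation_line F \<gamma> \<and> separates \<gamma> c c')}"

text \<open>Only meaningful for \<open>c \<notin> ray_locus F\<close>.\<close>

definition fiber :: "family \<Rightarrow> complex \<Rightarrow> complex set" where
  "fiber F c = extended_fiber F c - ray_locus F"

definition all_fibers_trivial :: "family \<Rightarrow> bool" where
  "all_fibers_trivial F \<longleftrightarrow> (\<forall>c. c \<notin> ray_locus F \<longrightarrow> is_singleton (fiber F c))"

end

theory Submission
  imports Defs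
begin

text \<open>
  A separation line meets a connected open set free of hyperbolic parameters in at most finitely
  many parabolic points, hence not at all, because an arc has no isolated points. Such a set
  therefore lies in a single extended fiber. A nonempty open set is not covered by parameter
  rays: a disc inside the escape locus would lie in one path component, whereas a countable union
  of compact arcs has empty interior by Baire. So every nonempty open set free of hyperbolic
  parameters yields a nontrivial fiber. Under triviality hyperbolic parameters are thus dense,
  and every component of the open set \<open>\<R>\<close> meets, hence is, a hyperbolic component;
  density of \<open>\<R>\<close> itself need not be known.
\<close>

section \<open>Openness of the stability locus\<close>

text \<open>Every iterate other than the identity is an iterate composed with \<open>f\<close>. A
  limit of iterates on \<open>U\<close>, finite or infinite, therefore pulls back along
  \<open>f\<close> to a limit on the preimage.\<close>

lemma normal_family_vimage:
  fixes f :: "complex \<Rightarrow> complex"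
  assumes f: "continuous_on UNIV f" and U: "normal_family U (range (\<lambda>n. f ^^ n))"
  shows "normal_family (f -` U) (range (\<lambda>n. f ^^ n))"
  unfolding normal_family_def
proof (intro allI impI)
  fix s :: "nat \<Rightarrow> complex \<Rightarrow> complex"
  assume s: "range s \<subseteq> range (\<lambda>n. f ^^ n)"
  then have "\<forall>k. \<exists>n. s k = f ^^ n" by blast
  then obtain n where n: "\<And>k. s k = f ^^ n k" by metis
  show "\<exists>r::nat \<Rightarrow> nat. strict_mono r \<and>
           ((\<exists>g. \<forall>K. compact K \<and> K \<subseteq> f -` U \<longrightarrow> uniform_limit K (s \<circ> r) g sequentially) \<or>
            locally_uniform_to_infinity (f -` U) (s \<circ> r))"
  \<comment> \<open>Exponent 0 is the one case in which no factor \<open>f\<close> can be split off.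
    If it recurs infinitely often, a subsequence is constantly the identity; otherwise a shift by
    \<open>N\<close> leaves it behind.\<close>
  proof (cases "infinite {k. n k = 0}")
    case True
    then obtain r :: "nat \<Rightarrow> nat" where r: "strict_mono r" "\<And>k. r k \<in> {k. n k = 0}"
      using infinite_enumerate by blast
    have "uniform_limit K (s \<circ> r) id sequentially" for K
      using r(2) by (auto simp: n uniform_limit_iff)
    then show ?thesis using r(1) by blast
  next
    case False
    then obtain N where N: "\<And>k. n k = 0 \<Longrightarrow> k < N"
      using finite_nat_set_iff_bounded[of "{k. n k = 0}"] by blast
    \<comment> \<open>The shift by \<open>N\<close> makes the exponent positive, so the subtraction
      on naturals is exact and \<open>s (k + N)\<close> is \<open>s' k\<close> after
      \<open>f\<close>.\<close>
    define s' where "s' k = f ^^ (n (k + N) - 1)" for k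
    have s': "s (k + N) z = s' k (f z)" for k z
    proof -
      have "n (k + N) \<noteq> 0" using N[of "k + N"] by auto
      then obtain m where "n (k + N) = Suc m" by (cases "n (k + N)") auto
      then show ?thesis by (simp add: n s'_def funpow_swap1)
    qed
    have "range s' \<subseteq> range (\<lambda>n. f ^^ n)" by (auto simp: s'_def)
    with U obtain r where r: "strict_mono r"
      and lim: "(\<exists>g. \<forall>K. compact K \<and> K \<subseteq> U \<longrightarrow> uniform_limit K (s' \<circ> r) g sequentially) \<or>
            locally_uniform_to_infinity U (s' \<circ> r)"
      unfolding normal_family_def by blast
    define r' where "r' k = r k + N" for k
    have r': "strict_mono r'" using r by (auto simp: r'_def strict_mono_def)
    have eq: "(s \<circ> r') k z = (s' \<circ> r) k (f z)" for k z by (simp add: r'_def s')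
    \<comment> \<open>Locally uniform control transfers because a compact \<open>K\<close> in the
      preimage is tested on its compact image in \<open>U\<close>.\<close>
    have K: "compact (f ` K) \<and> f ` K \<subseteq> U" if "compact K \<and> K \<subseteq> f -` U" for K
      using that f by (auto intro: compact_continuous_image continuous_on_subset)
    from lim show ?thesis
    proof
      assume "\<exists>g. \<forall>K. compact K \<and> K \<subseteq> U \<longrightarrow> uniform_limit K (s' \<circ> r) g sequentially"
      then obtain g where
        g: "\<And>K. compact K \<and> K \<subseteq> U \<Longrightarrow> uniform_limit K (s' \<circ> r) g sequentially"
        by blast
      have "uniform_limit K (s \<circ> r') (g \<circ> f) sequentially" if "compact K \<and> K \<subseteq> f -` U" for K
        using g[OF K[OF that]] unfolding uniform_limit_iff eq by simp
      then show ?thesis using r' by blast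
    next
      assume inf: "locally_uniform_to_infinity U (s' \<circ> r)"
      have "locally_uniform_to_infinity (f -` U) (s \<circ> r')"
        unfolding locally_uniform_to_infinity_def eq
      proof (intro allI impI)
        fix K B assume "compact K \<and> K \<subseteq> f -` U"
        then have "\<forall>\<^sub>F n in sequentially. \<forall>z\<in>f ` K. B \<le> norm ((s' \<circ> r) n z)"
          using inf K unfolding locally_uniform_to_infinity_def by blast
        then show "\<forall>\<^sub>F n in sequentially. \<forall>z\<in>K. B \<le> norm ((s' \<circ> r) n (f z))"
          by simp
      qed
      then show ?thesis using r' by blast
    qed
  qed
qed

lemma julia_set_forward_invariant:
  assumes "continuous_on UNIV f" "z \<in> julia_set f"
  shows "f z \<in> julia_set f"
proof (rule ccontr)
  assume "f z \<notin> julia_set f"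
  then obtain U where U: "open U" "f z \<in> U" "normal_family U (range (\<lambda>n. f ^^ n))"
    by (auto simp: julia_set_def fatou_set_def)
  have "open (f -` U)" using U(1) assms(1) by (rule open_vimage)
  then have "z \<in> fatou_set f"
    unfolding fatou_set_def using U normal_family_vimage[OF assms(1) U(3)] by blast
  then show False using assms(2) by (simp add: julia_set_def)
qed

lemma continuous_on_fam: "continuous_on A (fam F c)"
proof -
  have "fam F c = (\<lambda>z. case F of Quadratic \<Rightarrow> z\<^sup>2 + c | Exponential \<Rightarrow> exp z + c)"
    by (cases F) auto
  then show ?thesis by (cases F) (auto intro!: continuous_on_add continuous_on_power continuous_on_exp)
qed

text \<open>The conjugacies witnessing stability all start from the Julia set at the centre
  \<open>c\<close>. To recentre them at a nearby \<open>c'\<close>, go back to \<open>c\<close> by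
  the inverse \<open>g\<close> of \<open>h c'\<close> and then forward by
  \<open>h c''\<close>.\<close>

lemma open_stability_locus: "open (stability_locus F)"
  unfolding open_contains_ball
proof
  fix c assume "c \<in> stability_locus F"
  then obtain \<epsilon> h where \<epsilon>: "\<epsilon> > 0"
    and hom: "\<And>c'. c' \<in> ball c \<epsilon> \<Longrightarrow>
      \<exists>g. homeomorphism (julia_set (fam F c)) (julia_set (fam F c')) (h c') g"
    and conj: "\<And>c' z. c' \<in> ball c \<epsilon> \<Longrightarrow> z \<in> julia_set (fam F c) \<Longrightarrow>
      h c' (fam F c z) = fam F c' (h c' z)"
    and cont: "continuous_on (ball c \<epsilon> \<times> julia_set (fam F c)) (\<lambda>(c', z). h c' z)"
    unfolding stability_locus_def stable_def by blast
  let ?J = "\<lambda>c. julia_set (fam F c)"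
  have "stable F c'" if c': "c' \<in> ball c \<epsilon>" for c'
  proof -
    obtain g where g: "homeomorphism (?J c) (?J c') (h c') g" using hom[OF c'] by blast
    obtain \<delta> where \<delta>: "\<delta> > 0" "ball c' \<delta> \<subseteq> ball c \<epsilon>"
      using c' open_ball open_contains_ball by blast
    have gJ: "g z \<in> ?J c" "h c' (g z) = z" if "z \<in> ?J c'" for z
      using g that by (auto simp: homeomorphism_def)
    have gconj: "g (fam F c' z) = fam F c (g z)" if z: "z \<in> ?J c'" for z
    proof -
      have "fam F c' z = h c' (fam F c (g z))" using conj[OF c' gJ(1)[OF z]] gJ(2)[OF z] by simp
      \<comment> \<open>\<open>g\<close> inverts \<open>h c'\<close> only on the Julia set, so
        cancelling them at this point requires forward invariance.\<close>
      moreover have "fam F c (g z) \<in> ?J c"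
        by (rule julia_set_forward_invariant[OF continuous_on_fam gJ(1)[OF z]])
      ultimately show ?thesis using homeomorphism_apply1[OF g] by simp
    qed
    have "\<exists>g'. homeomorphism (?J c') (?J c'') (h c'' \<circ> g) g'" if c'': "c'' \<in> ball c' \<delta>" for c''
    proof -
      obtain g' where "homeomorphism (?J c) (?J c'') (h c'') g'" using hom c'' \<delta>(2) by blast
      then show ?thesis using homeomorphism_compose[OF homeomorphism_symD[OF g]] by blast
    qed
    moreover have "(h c'' \<circ> g) (fam F c' z) = fam F c'' ((h c'' \<circ> g) z)"
      if "c'' \<in> ball c' \<delta>" "z \<in> ?J c'" for c'' z
      using conj[of c'' "g z"] that \<delta>(2) gJ gconj by auto
    \<comment> \<open>The recentred family is the jointly continuous \<open>h\<close> precomposed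
      with (c'', z) \<mapsto> (c'', g z).\<close>
    moreover have "continuous_on (ball c' \<delta> \<times> ?J c') (\<lambda>(c'', z). (h c'' \<circ> g) z)"
    proof -
      have "continuous_on (ball c' \<delta> \<times> ?J c') (\<lambda>p. (fst p, g (snd p)))"
        by (intro continuous_intros continuous_on_compose2[OF homeomorphism_cont2[OF g]]) auto
      moreover have "(\<lambda>p. (fst p, g (snd p))) ` (ball c' \<delta> \<times> ?J c') \<subseteq> ball c \<epsilon> \<times> ?J c"
        using \<delta>(2) gJ by auto
      ultimately show ?thesis
        using continuous_on_compose2[OF cont, of _ "\<lambda>p. (fst p, g (snd p))"]
        by (simp add: case_prod_unfold)
    qed
    ultimately show ?thesis unfolding stable_def
      by (intro exI[of _ \<delta>] conjI exI[of _ "\<lambda>c''. h c'' \<circ> g"] \<delta>(1)) blast+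
  qed
  then show "\<exists>\<epsilon>>0. ball c \<epsilon> \<subseteq> stability_locus F"
    using \<epsilon> by (auto simp: stability_locus_def)
qed

lemma open_hyperbolic_parameters: "open (hyperbolic_parameters F)"
  unfolding hyperbolic_parameters_def hyperbolic_component_def
  using open_components[OF open_stability_locus] by (intro open_Union) blast

section \<open>Parameter rays\<close>

text \<open>By compactness the inverse of \<open>G\<close> is continuous on the image. On a nonempty
  interior it would embed a plane open set into the line, against invariance of dimension.\<close>

lemma interior_compact_curve_empty:
  fixes G :: "real \<Rightarrow> complex"
  assumes "compact K" "continuous_on K G" "inj_on G K"
  shows "interior (G ` K) = {}"
proof (rule ccontr)
  assume ne: "interior (G ` K) \<noteq> {}"
  obtain H where H: "homeomorphism K (G ` K) G H"
    using homeomorphism_compact[OF assms(1,2) refl assms(3)] by blast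
  have "continuous_on (interior (G ` K)) H"
    using homeomorphism_cont2[OF H] interior_subset by (rule continuous_on_subset)
  moreover have "inj_on H (interior (G ` K))"
    using homeomorphism_apply2[OF H] interior_subset by (intro inj_on_inverseI[of _ G]) blast
  ultimately have "DIM(complex) \<le> DIM(real)"
    using invariance_of_dimension[of "interior (G ` K)" H] ne by auto
  then show False by simp
qed

text \<open>The complement of each compact piece of the curve is open and dense. By Baire the
  countable intersection of these complements is dense, so the whole curve has no interior.\<close>

lemma interior_injective_curve_empty:
  fixes G :: "real \<Rightarrow> complex"
  assumes "countable \<K>" "\<And>K. K \<in> \<K> \<Longrightarrow> compact K"
    and "continuous_on (\<Union>\<K>) G" "inj_on G (\<Union>\<K>)"
  shows "interior (G ` \<Union>\<K>) = {}"
proof -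
  define \<G> where "\<G> = (\<lambda>K. - G ` K) ` \<K>"
  have "open (- G ` K) \<and> closure (- G ` K) = UNIV" if K: "K \<in> \<K>" for K
  proof -
    have "continuous_on K G" "inj_on G K"
      using assms(3,4) K by (meson Union_upper continuous_on_subset inj_on_subset)+
    then show ?thesis
      using interior_compact_curve_empty[of K G] assms(2)[OF K]
      by (simp add: closure_complement compact_continuous_image compact_imp_closed open_Compl)
  qed
  then have "UNIV \<subseteq> closure (\<Inter>\<G>)"
    using assms(1) by (intro Baire) (auto simp: \<G>_def)
  moreover have "\<Inter>\<G> = - G ` \<Union>\<K>" by (auto simp: \<G>_def)
  ultimately show ?thesis by (auto simp: closure_complement)
qed

text \<open>The base point of the path component in \<open>parameter_ray\<close> is arbitrary; here
  it is moved to \<open>c\<close> itself, which lies in the same component.\<close>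

lemma ray_locusE:
  assumes "c \<in> ray_locus Exponential"
  obtains G :: "real \<Rightarrow> complex" and T where "T = {0<..} \<or> T = {0..}"
    "continuous_on T G" "inj_on G T"
    "G ` T = path_component_set (escape_locus Exponential) c" "c \<in> G ` T"
proof -
  obtain A where "parameter_ray A" and c: "c \<in> A" using assms by force
  then obtain G :: "real \<Rightarrow> complex" and T d where T: "T = {0<..} \<or> T = {0..}"
    and G: "continuous_on T G" "inj_on G T"
    and comp: "G ` T = path_component_set (escape_locus Exponential) d" and A: "A = G ` {0<..}"
    unfolding parameter_ray_def by blast
  have "{0<..} \<subseteq> T" using T by auto
  then have "c \<in> G ` T" using c A by blast
  moreover from this have "G ` T = path_component_set (escape_locus Exponential) c"
    unfolding comp by (metis mem_Collect_eq path_component_eq)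
  ultimately show ?thesis using that T G by blast
qed

lemma interior_parameter_ray_component_empty:
  fixes G :: "real \<Rightarrow> complex"
  assumes "T = {0<..} \<or> T = {0..}" "continuous_on T G" "inj_on G T"
  shows "interior (G ` T) = {}"
proof -
  obtain C :: "nat \<Rightarrow> real set" where C: "\<And>n. compact (C n)" "\<Union>(range C) = {0<..}"
    using open_Union_compact_subsets[OF open_greaterThan] by metis
  have "\<exists>\<K>. countable \<K> \<and> (\<forall>K\<in>\<K>. compact K) \<and> \<Union>\<K> = T"
    using assms(1)
  proof
    assume "T = {0<..}"
    then show ?thesis using C by (intro exI[of _ "range C"]) auto
  next
    assume "T = {0..}"
    then have "T = \<Union>(insert {0} (range C))" using C(2) by auto
    then show ?thesis using C(1) by (intro exI[of _ "insert {0} (range C)"]) auto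
  qed
  then obtain \<K> where "countable \<K>" "\<And>K. K \<in> \<K> \<Longrightarrow> compact K" "\<Union>\<K> = T" by blast
  then show ?thesis using interior_injective_curve_empty[of \<K> G] assms(2,3) by simp
qed

lemma interior_ray_locus: "interior (ray_locus F) = {}"
proof (cases F)
  case Exponential
  show ?thesis
  proof (rule ccontr)
    assume "interior (ray_locus F) \<noteq> {}"
    then obtain c \<epsilon> where \<epsilon>: "\<epsilon> > 0" "ball c \<epsilon> \<subseteq> ray_locus Exponential"
      by (auto simp: mem_interior Exponential simp del: ray_locus.simps)
    then obtain G :: "real \<Rightarrow> complex" and T where T: "T = {0<..} \<or> T = {0..}"
      and G: "continuous_on T G" "inj_on G T"
      and comp: "G ` T = path_component_set (escape_locus Exponential) c"
      using centre_in_ball ray_locusE by (metis subsetD)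
    \<comment> \<open>The ball might be covered by many different rays. Once it lies in the escape
      locus, its path connectedness forces it into the single path component of \<open>c\<close>,
      which is one curve.\<close>
    have "ball c \<epsilon> \<subseteq> escape_locus Exponential"
    proof
      fix x assume "x \<in> ball c \<epsilon>"
      then have "x \<in> ray_locus Exponential" using \<epsilon>(2) by (rule subsetD[rotated])
      then obtain G :: "real \<Rightarrow> complex" and T where
        "G ` T = path_component_set (escape_locus Exponential) x" "x \<in> G ` T"
        by (rule ray_locusE)
      then show "x \<in> escape_locus Exponential"
        using path_component_subset by (metis subsetD)
    qed
    then have "ball c \<epsilon> \<subseteq> G ` T"
      unfolding comp using \<epsilon>(1)
      by (intro path_component_maximal convex_imp_path_connected) auto
    then have "c \<in> interior (G ` T)" using \<epsilon>(1) by (auto simp: mem_interior)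
    then show False using interior_parameter_ray_component_empty[OF T G] by simp
  qed
qed simp

section \<open>Density of hyperbolic parameters\<close>

text \<open>If the arc met \<open>D\<close>, the parameters landing in \<open>D\<close> would form a
  nonempty open, hence infinite, subset of the line. Injectivity would then give infinitely many
  parabolic points on the arc.\<close>

lemma separation_line_disjoint:
  assumes "open D" "D \<inter> hyperbolic_parameters F = {}" "separation_line F \<gamma>"
  shows "D \<inter> \<gamma> = {}"
proof (rule ccontr)
  assume ne: "D \<inter> \<gamma> \<noteq> {}"
  obtain g :: "real \<Rightarrow> complex" where g: "continuous_on UNIV g" "inj g" "\<gamma> = range g"
    and sub: "\<gamma> \<subseteq> hyperbolic_parameters F \<union> parabolic_parameters F"
    and fin: "finite (\<gamma> \<inter> parabolic_parameters F)"
    using assms(3) unfolding separation_line_def by blast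
  have "open (g -` D)" using assms(1) g(1) by (rule open_vimage)
  then have "infinite (g -` D)" using ne g(3) finite_imp_not_open by blast
  then have "infinite (g ` (g -` D))"
    using g(2) by (meson finite_imageD inj_on_subset subset_UNIV)
  moreover have "g ` (g -` D) \<subseteq> \<gamma> \<inter> parabolic_parameters F"
    using assms(2) sub g(3) by blast
  ultimately show False using fin finite_subset by blast
qed

lemma connected_subset_extended_fiber:
  assumes "open D" "connected D" "D \<inter> hyperbolic_parameters F = {}" "c \<in> D"
  shows "D \<subseteq> extended_fiber F c"
proof
  fix c' assume c': "c' \<in> D"
  have "\<not> separates \<gamma> c c'" if \<gamma>: "separation_line F \<gamma>" for \<gamma>
  proof
    assume "separates \<gamma> c c'"
    then obtain A B where AB: "A \<in> components (- \<gamma>)" "B \<in> components (- \<gamma>)" "A \<noteq> B"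
      "c \<in> A" "c' \<in> B"
      unfolding separates_def by blast
    have "D \<subseteq> - \<gamma>" using separation_line_disjoint[OF assms(1,3) \<gamma>] by blast
    then have "D \<subseteq> A" using AB(1,4) assms(2,4) by (intro components_maximal[of A "- \<gamma>"]) auto
    then show False using AB c' components_nonoverlap by fastforce
  qed
  then show "c' \<in> extended_fiber F c" by (auto simp: extended_fiber_def)
qed

lemma closure_hyperbolic_parameters:
  assumes triv: "all_fibers_trivial F"
  shows "closure (hyperbolic_parameters F) = UNIV"
proof (rule ccontr)
  assume "closure (hyperbolic_parameters F) \<noteq> UNIV"
  then obtain a where "a \<in> - closure (hyperbolic_parameters F)" by blast
  then obtain \<epsilon> where \<epsilon>: "\<epsilon> > 0" "ball a \<epsilon> \<subseteq> - closure (hyperbolic_parameters F)"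
    using open_contains_ball[of "- closure (hyperbolic_parameters F)"] by blast
  define D where "D = ball a \<epsilon>"
  have D: "open D" "connected D" "D \<inter> hyperbolic_parameters F = {}"
    using \<epsilon> closure_subset[of "hyperbolic_parameters F"] by (auto simp: D_def)
  have not_ray: "\<not> V \<subseteq> ray_locus F" if "open V" "V \<noteq> {}" for V
    using interior_maximal[of V "ray_locus F"] that interior_ray_locus[of F] by auto
  have "D \<noteq> {}" using \<epsilon>(1) by (auto simp: D_def)
  then obtain c where c: "c \<in> D" "c \<notin> ray_locus F" using not_ray[OF D(1)] by blast
  have "infinite D" using D(1) \<open>D \<noteq> {}\<close> finite_imp_not_open by blast
  \<comment> \<open>Removing \<open>c\<close> leaves a nonempty open set, which again cannot be
    covered by rays; this supplies a second point of the reduced fiber of \<open>c\<close>.\<close>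
  then have "D - {c} \<noteq> {}" by (metis finite.emptyI infinite_remove)
  then obtain c' where c': "c' \<in> D" "c' \<noteq> c" "c' \<notin> ray_locus F"
    using not_ray[of "D - {c}"] D(1) by auto
  have "{c, c'} \<subseteq> fiber F c"
    using connected_subset_extended_fiber[OF D c(1)] c c' by (auto simp: fiber_def)
  moreover have "is_singleton (fiber F c)" using triv c(2) by (simp add: all_fibers_trivial_def)
  ultimately show False using c'(2) by (auto simp: is_singleton_def)
qed

text \<open>Hyperbolic components are themselves components of the stability locus, so a component
  that meets one coincides with it. Openness of \<open>U\<close> lets density provide the meeting
  point.\<close>

lemma components_stability_locus_hyperbolic:
  assumes dense: "closure (hyperbolic_parameters F) = UNIV"
    and U: "U \<in> components (stability_locus F)"
  shows "hyperbolic_component F U"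
proof -
  have "open U" "U \<noteq> {}"
    using U open_components[OF open_stability_locus] in_components_nonempty by auto
  then have "U \<inter> hyperbolic_parameters F \<noteq> {}"
    using open_Int_closure_eq_empty[of U "hyperbolic_parameters F"] dense by auto
  then obtain V where V: "hyperbolic_component F V" "U \<inter> V \<noteq> {}"
    unfolding hyperbolic_parameters_def by blast
  then have "V = U"
    using U components_nonoverlap unfolding hyperbolic_component_def by blast
  then show ?thesis using V(1) by simp
qed

theorem theorem9:
  assumes "all_fibers_trivial Quadratic" and "all_fibers_trivial Exponential"
  shows "\<forall>F. (\<forall>U\<in>components (stability_locus F). hyperbolic_component F U) \<and>
             open (hyperbolic_parameters F) \<and>
             closure (hyperbolic_parameters F) = UNIV"
proof
  fix F
  have "all_fibers_trivial F" using assms by (cases F) auto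
  then have "closure (hyperbolic_parameters F) = UNIV" by (rule closure_hyperbolic_parameters)
  then show "(\<forall>U\<in>components (stability_locus F). hyperbolic_component F U) \<and>
             open (hyperbolic_parameters F) \<and> closure (hyperbolic_parameters F) = UNIV"
    using components_stability_locus_hyperbolic open_hyperbolic_parameters by blast
qed

end
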